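(* For every constant $K$ there is a constant $C=C(K)>0$ such that for every integer $n\ge 1$ and every caterpillar $T_n$ on $n$ vertices whose maximum degree is at most $K$ or whose number of non-leaf vertices is at most $K$, $R_g(T_n)\le C n^2$.
   Context: All graphs are finite and simple. A caterpillar is a tree such that the subgraph induced by all its non-leaf vertices is a path (possibly empty or a single vertex); a leaf is a vertex of degree 1. A finite set $P$ of points in the plane is in general position if no three of its points are collinear. $K_P$ denotes the complete geometric graph on $P$: its vertices are the points of $P$ and its edges are all straight line segments between two points of $P$. A subgraph of $K_P$ is non-crossing if no two of its edges cross each other. For an outerplanar graph $G$ (in particular for a tree), $R_g(G)$ is the minimum integer $N$ such that for every set $P$ of $N$ points in the plane in general position and every colouring of the edges of $K_P$ with two colours, there is a monochromatic non-crossing subgraph of $K_P$ isomorphic to $G$. *)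

theory Defs
  imports "HOL-Analysis.Analysis"
begin

section \<open>Finite simple graphs\<close>

record 'a ugraph =
  verts :: "'a set"
  edges :: "'a set set"

definition simple_graph :: "'a ugraph \<Rightarrow> bool" where
  "simple_graph G \<longleftrightarrow> finite (verts G) \<and> edges G \<subseteq> {e. e \<subseteq> verts G \<and> card e = 2}"

definition subgraph_of :: "'a ugraph \<Rightarrow> 'a ugraph \<Rightarrow> bool" where
  "subgraph_of H G \<longleftrightarrow> simple_graph H \<and> verts H \<subseteq> verts G \<and> edges H \<subseteq> edges G"

definition induced_on :: "'a ugraph \<Rightarrow> 'a set \<Rightarrow> 'a ugraph" where
  "induced_on G S = \<lparr>verts = verts G \<inter> S, edges = {e \<in> edges G. e \<subseteq> S}\<rparr>"

definition isomorphic :: "'a ugraph \<Rightarrow> 'b ugraph \<Rightarrow> bool" where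
  "isomorphic G H \<longleftrightarrow>
     (\<exists>f. bij_betw f (verts G) (verts H) \<and> edges H = (\<lambda>e. f ` e) ` edges G)"

definition degree_in :: "'a ugraph \<Rightarrow> 'a \<Rightarrow> nat" where
  "degree_in G v = card {e \<in> edges G. v \<in> e}"

text \<open>Only meaningful for graphs with at least one vertex.\<close>
definition max_degree :: "'a ugraph \<Rightarrow> nat" where
  "max_degree G = Max (degree_in G ` verts G)"

definition leaf :: "'a ugraph \<Rightarrow> 'a \<Rightarrow> bool" where
  "leaf G v \<longleftrightarrow> v \<in> verts G \<and> degree_in G v = 1"

definition nonleaf_verts :: "'a ugraph \<Rightarrow> 'a set" where
  "nonleaf_verts G = {v \<in> verts G. \<not> leaf G v}"

definition connected_graph :: "'a ugraph \<Rightarrow> bool" where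
  "connected_graph G \<longleftrightarrow> verts G \<noteq> {} \<and>
     (\<forall>u\<in>verts G. \<forall>v\<in>verts G. (u, v) \<in> {(x, y). {x, y} \<in> edges G}\<^sup>*)"

definition is_cycle :: "'a ugraph \<Rightarrow> 'a list \<Rightarrow> bool" where
  "is_cycle G xs \<longleftrightarrow> distinct xs \<and> length xs \<ge> 3 \<and> set xs \<subseteq> verts G \<and>
     (\<forall>i. Suc i < length xs \<longrightarrow> {xs ! i, xs ! Suc i} \<in> edges G) \<and> {last xs, hd xs} \<in> edges G"

definition tree_graph :: "'a ugraph \<Rightarrow> bool" where
  "tree_graph G \<longleftrightarrow> simple_graph G \<and> connected_graph G \<and> (\<nexists>xs. is_cycle G xs)"

text \<open>The list may be empty or a singleton, so the empty graph and the one-vertex graph are paths.\<close>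
definition path_graph :: "'a ugraph \<Rightarrow> bool" where
  "path_graph G \<longleftrightarrow> (\<exists>xs. distinct xs \<and> verts G = set xs \<and>
     edges G = {{xs ! i, xs ! Suc i} | i. Suc i < length xs})"

definition caterpillar :: "'a ugraph \<Rightarrow> bool" where
  "caterpillar G \<longleftrightarrow> tree_graph G \<and> path_graph (induced_on G (nonleaf_verts G))"


section \<open>Geometric graphs\<close>

type_synonym point = "real ^ 2"

definition general_position :: "point set \<Rightarrow> bool" where
  "general_position P \<longleftrightarrow> finite P \<and>
     (\<forall>a\<in>P. \<forall>b\<in>P. \<forall>c\<in>P. a \<noteq> b \<and> b \<noteq> c \<and> a \<noteq> c \<longrightarrow> \<not> collinear {a, b, c})"

text \<open>An edge \<open>{a, b}\<close> stands for the straight line segment between \<open>a\<close> and \<open>b\<close>.\<close>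
definition complete_geometric :: "point set \<Rightarrow> point ugraph" where
  "complete_geometric P = \<lparr>verts = P, edges = {e. e \<subseteq> P \<and> card e = 2}\<rparr>"

text \<open>Crossing means meeting in a point interior to both segments; on points in general position
  this is the only way in which two distinct edges can meet other than in a common endpoint.\<close>
definition edges_cross :: "point set \<Rightarrow> point set \<Rightarrow> bool" where
  "edges_cross e f \<longleftrightarrow> e \<noteq> f \<and>
     (\<exists>a b c d. e = {a, b} \<and> f = {c, d} \<and> open_segment a b \<inter> open_segment c d \<noteq> {})"

definition non_crossing :: "point ugraph \<Rightarrow> bool" where
  "non_crossing H \<longleftrightarrow> (\<forall>e\<in>edges H. \<forall>f\<in>edges H. \<not> edges_cross e f)"

definition monochromatic :: "('a set \<Rightarrow> bool) \<Rightarrow> 'a ugraph \<Rightarrow> bool" where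
  "monochromatic col H \<longleftrightarrow> (\<exists>k. \<forall>e\<in>edges H. col e = k)"

text \<open>The two colours are the truth values; the values of \<open>col\<close> outside the edges of the complete
  geometric graph are irrelevant.\<close>
definition geometric_ramsey_property :: "'a ugraph \<Rightarrow> nat \<Rightarrow> bool" where
  "geometric_ramsey_property G N \<longleftrightarrow>
     (\<forall>P. general_position P \<and> card P = N \<longrightarrow>
        (\<forall>col :: point set \<Rightarrow> bool. \<exists>H. subgraph_of H (complete_geometric P) \<and>
           monochromatic col H \<and> non_crossing H \<and> isomorphic G H))"

text \<open>The infimum in \<open>enat\<close> is the minimum if some \<open>N\<close> has the property, and \<open>\<infinity>\<close> otherwise; so a
  finite upper bound on it includes the existence of such an \<open>N\<close>.\<close>
definition geometric_ramsey_number :: "'a ugraph \<Rightarrow> enat" where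
  "geometric_ramsey_number G = Inf (enat ` {N. geometric_ramsey_property G N})"

end

theory Submission imports Defs begin

text \<open>
  The constant is \<open>C = 1\<close>: a monochromatic non-crossing copy is found by sweeping the
  \<open>n\<^sup>2\<close> points from left to right.

  List the vertices of the caterpillar along the spine, each spine vertex followed first by its
  leaves and then by the next spine vertex. Every vertex but the first has exactly one earlier
  neighbour, and the tree is a chain of stars: each star is centred at its first vertex, and its last
  vertex is the centre of the next star (\<open>caterpillar_swept\<close>). Order the points by a linear
  functional that separates them, say from left to right. If the vertices are placed from left to
  right in the order of the list, no two edges cross: two edges of one star share an end, and
  different stars occupy vertical strips with disjoint interiors
  (\<open>star_sequence_drawing_non_crossing\<close>). Thus the geometry reduces to a Ramsey question on
  ordered complete graphs.

  Suppose that there is no blue clique on \<open>n\<close> points, and say that a point is reached by a prefix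
  of the list if some red increasing copy of that prefix ends there. Consider points reached by the
  prefix ending at the centre of a star with \<open>d\<close> edges, but not by the prefix that includes the
  whole star. Each of them has fewer than \<open>d\<close> red neighbours to its right among these points, as
  otherwise the copy could be extended by the star. Such a set has a blue clique on at least a
  fraction \<open>1/d\<close> of its points, hence has at most \<open>d(n - 1)\<close> points. Every star costs at most
  that many points, and the stars have \<open>n - 1\<close> edges in total, so all but
  \<open>(n - 1)\<^sup>2\<close> points are reached by the whole list
  (\<open>few_points_end_no_red_drawing\<close>). In the other case, the \<open>n\<close> points of a blue clique
  taken from left to right already carry a blue copy.
\<close>

section \<open>Caterpillars as sequences of stars\<close>

text \<open>
  Vertices are numbers below \<open>n\<close>, and \<open>par k\<close> is the only earlier neighbour of \<open>k > 0\<close>. The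
  condition says that the edges into all vertices strictly after \<open>par k\<close> up to \<open>k\<close> start at the
  same centre, so that a new star can only be opened at the last vertex of the preceding one.
\<close>
definition star_sequence :: "(nat \<Rightarrow> nat) \<Rightarrow> nat \<Rightarrow> bool" where
  "star_sequence par n \<longleftrightarrow>
     (\<forall>k. 0 < k \<and> k < n \<longrightarrow> par k < k \<and> (\<forall>j. par k < j \<and> j \<le> k \<longrightarrow> par j = par k))"

lemma star_sequence_less: "star_sequence par n \<Longrightarrow> 0 < k \<Longrightarrow> k < n \<Longrightarrow> par k < k"
  unfolding star_sequence_def by blast

lemma star_sequence_const:
  "star_sequence par n \<Longrightarrow> k < n \<Longrightarrow> par k < j \<Longrightarrow> j \<le> k \<Longrightarrow> par j = par k"
  unfolding star_sequence_def by (metis gr0I le_zero_eq less_zeroE)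

text \<open>
  The vertex \<open>z\<close> is the centre of a star that is still open at the end of the list: either the
  current centre or the last vertex. This invariant makes it possible to build the list one vertex
  at a time.
\<close>
definition swept :: "'a set \<Rightarrow> 'a set set \<Rightarrow> 'a \<Rightarrow> bool" where
  "swept V E z \<longleftrightarrow> (\<exists>par L c. star_sequence par (length L) \<and> distinct L \<and> set L = V \<and>
     E = {{L ! par k, L ! k} | k. 0 < k \<and> k < length L} \<and>
     c < length L \<and> L ! c = z \<and> (\<forall>j. c < j \<and> j < length L \<longrightarrow> par j = c))"

lemma swept_singleton: "swept {v} {} v"
  unfolding swept_def star_sequence_def
  by (rule exI[of _ id], rule exI[of _ "[v]"], rule exI[of _ 0]) auto

text \<open>
  A vertex joined to the open centre may be treated as a leaf, so that the centre stays open, or as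
  the next spine vertex, which then becomes the open centre.
\<close>
lemma swept_attach:
  assumes "swept V E z" "w \<notin> V"
  shows "swept (insert w V) (insert {z, w} E) z" "swept (insert w V) (insert {z, w} E) w"
proof -
  obtain par L c where L: "star_sequence par (length L)" "distinct L" "set L = V"
      "E = {{L ! par k, L ! k} | k. 0 < k \<and> k < length L}"
      "c < length L" "L ! c = z" and c: "\<And>j. c < j \<Longrightarrow> j < length L \<Longrightarrow> par j = c"
    using assms(1) unfolding swept_def by blast
  \<comment> \<open>the new vertex gets the index \<open>length L\<close>\<close>
  let ?par = "par(length L := c)" and ?L = "L @ [w]"
  have lt: "par k < length L" if "0 < k" "k < length L" for k
    using star_sequence_less[OF L(1) that] that(2) by (rule less_trans)
  have "?par k < k \<and> (\<forall>j. ?par k < j \<and> j \<le> k \<longrightarrow> ?par j = ?par k)"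
    if "0 < k" "k < length ?L" for k
  proof (cases "k = length L")
    case True
    then show ?thesis using L(5) c by simp
  next
    case False
    then have "k < length L" using that(2) by simp
    then have "?par j = par j" if "j \<le> k" for j
      using that by simp
    then show ?thesis
      using star_sequence_less[OF L(1) that(1)] star_sequence_const[OF L(1)] \<open>k < length L\<close>
      by (metis le_refl)
  qed
  then have "star_sequence ?par (length ?L)"
    unfolding star_sequence_def by blast
  moreover have "insert {z, w} E = {{?L ! ?par k, ?L ! k} | k. 0 < k \<and> k < length ?L}"
    (is "_ = ?R")
  proof (rule set_eqI)
    fix e
    have "e \<in> ?R \<longleftrightarrow> (\<exists>k. 0 < k \<and> k < length L \<and> e = {?L ! ?par k, ?L ! k}) \<or>
        e = {?L ! ?par (length L), ?L ! length L}"
      using L(5) by (auto simp: less_Suc_eq)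
    also have "(\<exists>k. 0 < k \<and> k < length L \<and> e = {?L ! ?par k, ?L ! k}) \<longleftrightarrow>
        (\<exists>k. 0 < k \<and> k < length L \<and> e = {L ! par k, L ! k})"
      using lt by (intro ex_cong1) (auto simp: nth_append)
    finally show "e \<in> insert {z, w} E \<longleftrightarrow> e \<in> ?R"
      using L(4-6) by (auto simp: nth_append)
  qed
  moreover have "distinct ?L" "set ?L = insert w V"
    using L(2,3) assms(2) by auto
  moreover have "c < length ?L" "?L ! c = z" "\<forall>j. c < j \<and> j < length ?L \<longrightarrow> ?par j = c"
      "length L < length ?L" "?L ! length L = w"
      "\<forall>j. length L < j \<and> j < length ?L \<longrightarrow> ?par j = length L"
    using L(5,6) c by (auto simp: nth_append less_Suc_eq)
  ultimately show "swept (insert w V) (insert {z, w} E) z" "swept (insert w V) (insert {z, w} E) w"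
    unfolding swept_def by blast+
qed

lemma swept_attach_leaves:
  assumes "finite W" "swept V E z" "W \<inter> V = {}"
  shows "swept (V \<union> W) (E \<union> {{z, w} | w. w \<in> W}) z"
  using assms(1,3)
proof (induction W)
  case empty
  then show ?case using assms(2) by simp
next
  case (insert w W)
  have "swept (insert w (V \<union> W)) (insert {z, w} (E \<union> {{z, w} | w. w \<in> W})) z"
    using insert by (intro swept_attach) auto
  also have "insert {z, w} (E \<union> {{z, w} | w. w \<in> W}) = E \<union> {{z, u} | u. u \<in> insert w W}"
    by blast
  also have "insert w (V \<union> W) = V \<union> insert w W"
    by blast
  finally show ?case .
qed

text \<open>
  Induction along the spine: the next spine vertex is joined to the open centre and takes over its
  role, and then its own leaves are joined to it.
\<close>
lemma swept_spine:
  assumes "xs \<noteq> []" "distinct xs" "\<And>x. x \<in> set xs \<Longrightarrow> finite (lv x)"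
    "\<And>x y. x \<in> set xs \<Longrightarrow> y \<in> set xs \<Longrightarrow> x \<noteq> y \<Longrightarrow> lv x \<inter> lv y = {}"
    "\<And>x. x \<in> set xs \<Longrightarrow> lv x \<inter> set xs = {}"
  shows "swept (set xs \<union> (\<Union>x\<in>set xs. lv x))
    ({{xs ! i, xs ! Suc i} | i. Suc i < length xs} \<union> {{x, w} | x w. x \<in> set xs \<and> w \<in> lv x}) (last xs)"
  using assms
proof (induction xs rule: rev_nonempty_induct)
  case (single x)
  have "finite (lv x)" "lv x \<inter> {x} = {}"
    using single.prems(2,4)[of x] by simp_all
  from swept_attach_leaves[OF this(1) swept_singleton this(2)] show ?case
    by simp
next
  case (snoc x xs)
  let ?V = "set xs \<union> (\<Union>x\<in>set xs. lv x)"
  let ?E = "{{xs ! i, xs ! Suc i} | i. Suc i < length xs} \<union> {{x, w} | x w. x \<in> set xs \<and> w \<in> lv x}"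
  have "swept ?V ?E (last xs)"
  proof (rule snoc.IH)
    show "distinct xs" using snoc.prems(1) by simp
    show "finite (lv y)" if "y \<in> set xs" for y
      using that snoc.prems(2) by simp
    show "lv y \<inter> lv u = {}" if "y \<in> set xs" "u \<in> set xs" "y \<noteq> u" for y u
      using that by (intro snoc.prems(3)) simp_all
    show "lv y \<inter> set xs = {}" if "y \<in> set xs" for y
      using that snoc.prems(4)[of y] by auto
  qed
  moreover have "x \<notin> ?V"
    using snoc.prems(1,4) by auto
  ultimately have "swept (insert x ?V) (insert {last xs, x} ?E) x"
    by (rule swept_attach)
  moreover have "lv x \<inter> insert x ?V = {}"
  proof -
    have "lv x \<inter> lv y = {}" if "y \<in> set xs" for y
      using that snoc.prems(1,2) by (intro snoc.prems(3)) auto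
    then show ?thesis using snoc.prems(4)[of x] by auto
  qed
  ultimately have "swept (insert x ?V \<union> lv x) (insert {last xs, x} ?E \<union> {{x, w} | w. w \<in> lv x}) x"
    using snoc.prems(2) by (intro swept_attach_leaves) auto
  moreover have "insert x ?V \<union> lv x = set (xs @ [x]) \<union> (\<Union>x\<in>set (xs @ [x]). lv x)"
    by auto
  moreover have "{{(xs @ [x]) ! i, (xs @ [x]) ! Suc i} | i. Suc i < length (xs @ [x])}
      = insert {last xs, x} {{xs ! i, xs ! Suc i} | i. Suc i < length xs}" (is "?A = ?B")
  proof (rule set_eqI)
    fix e
    define m where "m = length xs - 1"
    have m: "length xs = Suc m" using snoc.hyps by (simp add: m_def)
    have "e \<in> ?A \<longleftrightarrow> (\<exists>i<Suc m. e = {(xs @ [x]) ! i, (xs @ [x]) ! Suc i})"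
      using m by auto
    also have "\<dots> \<longleftrightarrow> e = {(xs @ [x]) ! m, (xs @ [x]) ! Suc m} \<or>
        (\<exists>i<m. e = {(xs @ [x]) ! i, (xs @ [x]) ! Suc i})"
      unfolding less_Suc_eq by blast
    also have "\<dots> \<longleftrightarrow> e = {last xs, x} \<or> (\<exists>i<m. e = {xs ! i, xs ! Suc i})"
      using m snoc.hyps by (auto simp: nth_append last_conv_nth)
    finally show "e \<in> ?A \<longleftrightarrow> e \<in> ?B" using m by auto
  qed
  moreover have "{{y, w} | y w. y \<in> set (xs @ [x]) \<and> w \<in> lv y}
      = {{y, w} | y w. y \<in> set xs \<and> w \<in> lv y} \<union> {{x, w} | w. w \<in> lv x}"
    by auto
  ultimately show ?case by (simp add: Un_ac)
qed

lemma leaf_unique_neighbour: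
  assumes "leaf G v" "{v, a} \<in> edges G" "{v, b} \<in> edges G"
  shows "a = b"
proof -
  have "card {e \<in> edges G. v \<in> e} = 1"
    using assms(1) unfolding leaf_def degree_in_def by simp
  then obtain e where e: "{e \<in> edges G. v \<in> e} = {e}"
    by (rule card_1_singletonE)
  have "{v, a} \<in> {e \<in> edges G. v \<in> e}" "{v, b} \<in> {e \<in> edges G. v \<in> e}"
    using assms(2,3) by simp_all
  then have "{v, a} = {v, b}"
    unfolding e by simp
  then show ?thesis by (metis doubleton_eq_iff)
qed

lemma leaf_has_neighbour:
  assumes "simple_graph G" "leaf G v"
  obtains a where "{v, a} \<in> edges G" "a \<in> verts G" "a \<noteq> v"
proof -
  have "card {e \<in> edges G. v \<in> e} = 1"
    using assms(2) unfolding leaf_def degree_in_def by simp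
  then have "{e \<in> edges G. v \<in> e} \<noteq> {}"
    by (metis card.empty zero_neq_one)
  then obtain e where e: "e \<in> edges G" "v \<in> e"
    by blast
  then have "e \<subseteq> verts G" "card e = 2"
    using assms(1) unfolding simple_graph_def by auto
  then obtain a where "e = {v, a}" "a \<noteq> v"
    using e(2) by (auto simp: card_2_iff)
  then show ?thesis using that e \<open>e \<subseteq> verts G\<close> by auto
qed

text \<open>
  Two adjacent leaves have no neighbours besides each other, so nothing else can be reached from
  them. This is the only tree with an edge that avoids the spine.
\<close>
lemma connected_two_leaves:
  assumes "connected_graph G" "leaf G u" "leaf G v" "{u, v} \<in> edges G"
  shows "verts G = {u, v}"
proof -
  let ?R = "{(x, y). {x, y} \<in> edges G}"
  have "w \<in> {u, v}" if "(u, w) \<in> ?R\<^sup>*" for w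
    using that
  proof (induction rule: rtrancl_induct)
    case (step x y)
    then show ?case
      using leaf_unique_neighbour[OF assms(2), of y v] leaf_unique_neighbour[OF assms(3), of y u]
        assms(4) by (auto simp: insert_commute)
  qed simp
  then show ?thesis
    using assms(1-3) unfolding connected_graph_def leaf_def by blast
qed

text \<open>
  Apart from the single edge, whose spine is empty, every leaf is attached to exactly one spine
  vertex; these edges and the edges of the spine are all edges of the tree.
\<close>
lemma caterpillar_swept:
  assumes "caterpillar T"
  obtains z where "swept (verts T) (edges T) z"
proof (cases "\<exists>u v. leaf T u \<and> leaf T v \<and> {u, v} \<in> edges T")
  case True
  have simple: "simple_graph T" and conn: "connected_graph T"
    using assms unfolding caterpillar_def tree_graph_def by auto
  obtain u v where uv: "leaf T u" "leaf T v" "{u, v} \<in> edges T"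
    using True by blast
  have V: "verts T = {u, v}"
    using connected_two_leaves[OF conn uv] .
  have "u \<noteq> v"
    using uv(3) simple unfolding simple_graph_def by auto
  moreover have "edges T = {{u, v}}"
  proof -
    have "e = {u, v}" if "e \<in> edges T" for e
    proof -
      have "e \<subseteq> {u, v}" "card e = card {u, v}"
        using that simple V \<open>u \<noteq> v\<close> unfolding simple_graph_def by auto
      then show ?thesis by (intro card_subset_eq) auto
    qed
    then show ?thesis using uv(3) by blast
  qed
  ultimately show ?thesis
    using swept_attach(1)[OF swept_singleton, of v u] V that by (simp add: insert_commute)
next
  case False
  have simple: "simple_graph T" and conn: "connected_graph T"
    using assms unfolding caterpillar_def tree_graph_def by auto
  obtain xs where xs: "distinct xs" "nonleaf_verts T = set xs"
      "{e \<in> edges T. e \<subseteq> nonleaf_verts T} = {{xs ! i, xs ! Suc i} | i. Suc i < length xs}"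
    using assms unfolding caterpillar_def path_graph_def induced_on_def
    by (auto simp: nonleaf_verts_def Int_def)
  define lv where "lv x = {w. leaf T w \<and> {x, w} \<in> edges T}" for x
  have nonleaf: "x \<in> set xs \<longleftrightarrow> x \<in> verts T \<and> \<not> leaf T x" for x
    using xs(2) unfolding nonleaf_verts_def by auto
  have edge: "\<exists>a b. e = {a, b} \<and> a \<in> set xs \<and> b \<in> verts T" if "e \<in> edges T" for e
  proof -
    have "card e = 2" "e \<subseteq> verts T"
      using that simple unfolding simple_graph_def by auto
    then obtain a b where ab: "e = {a, b}" "a \<in> verts T" "b \<in> verts T"
      by (auto simp: card_2_iff)
    then have "a \<in> set xs \<or> b \<in> set xs"
      using False that nonleaf by blast
    then show ?thesis
      using ab by (metis insert_commute)
  qed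
  have covered: "\<exists>x\<in>set xs. w \<in> lv x" if "leaf T w" for w
  proof -
    obtain a where "{w, a} \<in> edges T" "a \<in> verts T"
      using leaf_has_neighbour[OF simple \<open>leaf T w\<close>] .
    then have "a \<in> set xs" "w \<in> lv a"
      using False that by (auto simp: nonleaf lv_def insert_commute)
    then show ?thesis by blast
  qed
  have V: "set xs \<union> (\<Union>x\<in>set xs. lv x) = verts T"
    using covered nonleaf by (auto simp: lv_def leaf_def)
  have E: "{{xs ! i, xs ! Suc i} | i. Suc i < length xs} \<union> {{x, w} | x w. x \<in> set xs \<and> w \<in> lv x}
      = edges T"
  proof -
    have "e \<in> {{x, w} | x w. x \<in> set xs \<and> w \<in> lv x}" if "e \<in> edges T" "\<not> e \<subseteq> set xs" for e
    proof -
      obtain a b where ab: "e = {a, b}" "a \<in> set xs" "b \<in> verts T"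
        using edge \<open>e \<in> edges T\<close> by blast
      then have "b \<in> lv a"
        using that by (auto simp: nonleaf lv_def)
      then show ?thesis using ab by blast
    qed
    moreover have "{{x, w} | x w. x \<in> set xs \<and> w \<in> lv x} \<subseteq> edges T"
      by (auto simp: lv_def)
    ultimately show ?thesis
      unfolding xs(3)[symmetric] xs(2) by blast
  qed
  have "verts T \<noteq> {}"
    using conn unfolding connected_graph_def by simp
  then have "xs \<noteq> []" using V by auto
  then have "swept (verts T) (edges T) (last xs)"
    unfolding V[symmetric] E[symmetric]
  proof (rule swept_spine[OF _ xs(1)])
    show "finite (lv x)" for x
      by (rule finite_subset[of _ "verts T"])
        (use simple in \<open>auto simp: lv_def leaf_def simple_graph_def\<close>)
    show "lv x \<inter> lv y = {}" if "x \<noteq> y" for x y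
      using leaf_unique_neighbour that by (fastforce simp: lv_def insert_commute)
    show "lv x \<inter> set xs = {}" for x
      by (auto simp: lv_def nonleaf)
  qed
  then show ?thesis using that by blast
qed

section \<open>Monochromatic star sequences in ordered complete graphs\<close>

lemma increasing_enumeration:
  fixes r :: "'b \<Rightarrow> real"
  assumes "finite A" "inj_on r A"
  obtains q where "\<And>i. i < card A \<Longrightarrow> q i \<in> A"
    "\<And>i j. i < j \<Longrightarrow> j < card A \<Longrightarrow> r (q i) < r (q j)"
proof -
  let ?L = "sorted_list_of_set (r ` A)"
  have len: "length ?L = card A"
    using assms by (simp add: card_image)
  have in_im: "?L ! i \<in> r ` A" if "i < card A" for i
    using that assms(1) len by (metis finite_imageI nth_mem set_sorted_list_of_set)
  show ?thesis
  proof (rule that[of "\<lambda>i. inv_into A r (?L ! i)"])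
    show "inv_into A r (?L ! i) \<in> A" if "i < card A" for i
      using in_im[OF that] by (rule inv_into_into)
    fix i j assume "i < j" "j < card A"
    then have "?L ! i < ?L ! j"
      using len by (intro sorted_wrt_nth_less[of "(<)"]) (auto simp: assms(1))
    then show "r (inv_into A r (?L ! i)) < r (inv_into A r (?L ! j))"
      using in_im \<open>i < j\<close> \<open>j < card A\<close> by (simp add: f_inv_into_f)
  qed
qed

text \<open>
  Greedy choice: take the leftmost point and discard it together with its red neighbours. All of
  these lie to its right, so at most \<open>d\<close> points are lost, and no remaining point is a red
  neighbour of the chosen one.
\<close>
lemma independent_set_of_few_right_neighbours:
  fixes r :: "'b \<Rightarrow> real"
  assumes "finite S" "inj_on r S" "m * d < card S"
    "\<And>v. v \<in> S \<Longrightarrow> card {w \<in> S. r v < r w \<and> red {v, w}} < d"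
  shows "\<exists>B\<subseteq>S. card B = Suc m \<and> (\<forall>v\<in>B. \<forall>w\<in>B. v \<noteq> w \<longrightarrow> \<not> red {v, w})"
  using assms
proof (induction m arbitrary: S)
  case 0
  then obtain v where "v \<in> S" by fastforce
  then show ?case by (intro exI[of _ "{v}"]) auto
next
  case (Suc m)
  then have "S \<noteq> {}" by auto
  then obtain v where v: "v \<in> S" "\<And>w. w \<in> S \<Longrightarrow> r v \<le> r w"
    using ex_min_if_finite[of "r ` S"] Suc.prems(1) by (metis (no_types, lifting) finite_imageI image_iff image_is_empty leI)
  let ?N = "{w \<in> S. r v < r w \<and> red {v, w}}"
  let ?S' = "S - insert v ?N"
  have "card (insert v ?N) \<le> d"
    using Suc.prems(1) Suc.prems(4)[OF v(1)] by (simp add: card_insert_if)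
  moreover have "card ?S' = card S - card (insert v ?N)"
    using Suc.prems(1) v(1) by (intro card_Diff_subset) auto
  ultimately have big: "m * d < card ?S'"
    using Suc.prems(3) by simp
  have "card {w \<in> ?S'. r u < r w \<and> red {u, w}} < d" if "u \<in> ?S'" for u
  proof -
    have "card {w \<in> ?S'. r u < r w \<and> red {u, w}} \<le> card {w \<in> S. r u < r w \<and> red {u, w}}"
      using Suc.prems(1) by (intro card_mono) auto
    then show ?thesis using Suc.prems(4)[of u] that by auto
  qed
  then obtain B where B: "B \<subseteq> ?S'" "card B = Suc m" "\<forall>x\<in>B. \<forall>w\<in>B. x \<noteq> w \<longrightarrow> \<not> red {x, w}"
    using Suc.IH[of ?S'] Suc.prems(1,2) big by (meson Diff_subset finite_Diff inj_on_subset)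
  have "\<not> red {v, w}" if "w \<in> B" for w
  proof -
    have "w \<in> S" "w \<noteq> v" "w \<notin> ?N" using that B(1) by auto
    moreover have "r v < r w"
      using v(2)[of w] \<open>w \<in> S\<close> \<open>w \<noteq> v\<close> v(1) Suc.prems(2) by (metis inj_on_eq_iff le_less)
    ultimately show ?thesis by blast
  qed
  moreover have "card (insert v B) = Suc (Suc m)"
    using B(1,2) Suc.prems(1) by (subst card_insert_disjoint) (auto dest: finite_subset)
  ultimately show ?case
    using B v(1) by (intro exI[of _ "insert v B"]) (auto simp: insert_commute)
qed

text \<open>
  The vertices \<open>0, \<dots>, k\<close> are placed, the last index included.
\<close>
definition red_drawing ::
  "'b set \<Rightarrow> ('b \<Rightarrow> real) \<Rightarrow> ('b set \<Rightarrow> bool) \<Rightarrow> (nat \<Rightarrow> nat) \<Rightarrow> nat \<Rightarrow> (nat \<Rightarrow> 'b) \<Rightarrow> bool" where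
  "red_drawing P r red par k p \<longleftrightarrow> (\<forall>i\<le>k. p i \<in> P) \<and>
     (\<forall>i j. i < j \<and> j \<le> k \<longrightarrow> r (p i) < r (p j)) \<and>
     (\<forall>j. 0 < j \<and> j \<le> k \<longrightarrow> red {p (par j), p j})"

text \<open>
  The vertices after \<open>par k\<close> up to \<open>k\<close> are exactly the part of one star with centre
  \<open>par k\<close>. So enough red neighbours to the right of the centre, taken in increasing order, are a
  valid continuation of the drawing.
\<close>
lemma red_drawing_append_star:
  fixes r :: "'b \<Rightarrow> real"
  assumes "star_sequence par n" "0 < k" "k < n"
    and p: "red_drawing P r red par (par k) p"
    and A: "finite A" "inj_on r A" "A \<subseteq> P" "card A = k - par k"
      "\<And>w. w \<in> A \<Longrightarrow> r (p (par k)) < r w \<and> red {p (par k), w}"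
  shows "\<exists>q. red_drawing P r red par k q \<and> q k \<in> A"
proof -
  define c where "c = par k"
  have c: "c < k" "\<And>j. c < j \<Longrightarrow> j \<le> k \<Longrightarrow> par j = c"
    using star_sequence_less[OF assms(1-3)] star_sequence_const[OF assms(1,3)]
    unfolding c_def by blast+
  have par_lt: "par j < j" if "0 < j" "j \<le> k" for j
    using assms(3) that by (intro star_sequence_less[OF assms(1)]) auto
  obtain s where s: "\<And>i. i < card A \<Longrightarrow> s i \<in> A"
      "\<And>i j. i < j \<Longrightarrow> j < card A \<Longrightarrow> r (s i) < r (s j)"
    using increasing_enumeration[OF A(1,2)] by blast
  define q where "q i = (if i \<le> c then p i else s (i - Suc c))" for i
  have q_in: "q i \<in> A" if "c < i" "i \<le> k" for i
    using that A(4) by (auto simp: q_def c_def intro!: s)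
  have p': "\<And>i. i \<le> c \<Longrightarrow> p i \<in> P" "\<And>i j. i < j \<Longrightarrow> j \<le> c \<Longrightarrow> r (p i) < r (p j)"
      "\<And>j. 0 < j \<Longrightarrow> j \<le> c \<Longrightarrow> red {p (par j), p j}"
    using p unfolding red_drawing_def c_def by auto
  have "q i \<in> P" if "i \<le> k" for i
    using that q_in[of i] p'(1)[of i] A(3) by (cases "i \<le> c") (auto simp: q_def)
  moreover have "r (q i) < r (q j)" if "i < j" "j \<le> k" for i j
  proof (cases "j \<le> c")
    case True
    then show ?thesis using that p'(2) by (simp add: q_def)
  next
    case False
    show ?thesis
    proof (cases "i \<le> c")
      case True
      then have "r (q i) \<le> r (p c)"
        using p'(2)[of i c] by (cases "i = c") (auto simp: q_def)
      also have "\<dots> < r (q j)"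
        using A(5)[OF q_in[of j]] False that by (simp add: c_def)
      finally show ?thesis .
    next
      case False
      then show ?thesis using that A(4) by (auto simp: q_def c_def intro!: s)
    qed
  qed
  moreover have "red {q (par j), q j}" if "0 < j" "j \<le> k" for j
  proof (cases "j \<le> c")
    case True
    then show ?thesis using that p'(3) par_lt[of j] by (simp add: q_def)
  next
    case False
    then show ?thesis using A(5)[OF q_in[of j]] c(2)[of j] that by (simp add: q_def c_def)
  qed
  ultimately show ?thesis
    using q_in[of k] c(1) unfolding red_drawing_def by blast
qed

text \<open>
  The core of the argument. Passing from the centre \<open>par k\<close> to \<open>k\<close> uses \<open>k - par k\<close>
  edges of one star and loses at most \<open>(k - par k) * m\<close> further points. These losses add up to
  \<open>k * m\<close>, since the induction jumps from \<open>k\<close> directly to the centre.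
\<close>
lemma few_points_end_no_red_drawing:
  fixes r :: "'b \<Rightarrow> real"
  assumes "finite P" "inj_on r P" "star_sequence par n"
    and no_blue: "\<And>B. B \<subseteq> P \<Longrightarrow> card B = Suc m \<Longrightarrow> \<exists>v\<in>B. \<exists>w\<in>B. v \<noteq> w \<and> red {v, w}"
  shows "k < n \<Longrightarrow> card {v \<in> P. \<nexists>p. red_drawing P r red par k p \<and> p k = v} \<le> k * m"
proof (induction k rule: less_induct)
  case (less k)
  let ?bad = "\<lambda>k. {v \<in> P. \<nexists>p. red_drawing P r red par k p \<and> p k = v}"
  show ?case
  proof (cases "k = 0")
    case True
    have "?bad 0 = {}"
    proof -
      have "red_drawing P r red par 0 (\<lambda>_. v)" if "v \<in> P" for v
        using that by (auto simp: red_drawing_def)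
      then show ?thesis by fastforce
    qed
    then have "card (?bad 0) = 0" by (metis card.empty)
    then show ?thesis unfolding True by (metis le0)
  next
    case False
    define c where "c = par k"
    have c: "c < k"
      unfolding c_def using False less.prems by (intro star_sequence_less[OF assms(3)]) auto
    \<comment> \<open>points that end a drawing up to the centre but none up to \<open>k\<close>\<close>
    define S where "S = ?bad k - ?bad c"
    have S: "S \<subseteq> P" "finite S" "inj_on r S"
      using assms(1,2) by (auto simp: S_def intro: finite_subset inj_on_subset)
    have few: "card {w \<in> S. r v < r w \<and> red {v, w}} < k - c" if "v \<in> S" for v
    proof (rule ccontr)
      assume "\<not> ?thesis"
      then obtain A where A: "A \<subseteq> {w \<in> S. r v < r w \<and> red {v, w}}" "card A = k - c"
        by (meson not_less obtain_subset_with_card_n)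
      \<comment> \<open>the star at \<open>v\<close> would lead to a point of \<open>S\<close> that does end a drawing up to \<open>k\<close>\<close>
      obtain p where p: "red_drawing P r red par c p" "p c = v"
        using \<open>v \<in> S\<close> unfolding S_def by blast
      have "\<exists>q. red_drawing P r red par k q \<and> q k \<in> A"
      proof (rule red_drawing_append_star[OF assms(3) _ less.prems])
        show "0 < k" using False by simp
        show "red_drawing P r red par (par k) p" using p by (simp add: c_def)
        show "finite A" "inj_on r A" "A \<subseteq> P"
          using A(1) S by (auto intro: finite_subset inj_on_subset)
        show "card A = k - par k" using A(2) by (simp add: c_def)
        show "r (p (par k)) < r w \<and> red {p (par k), w}" if "w \<in> A" for w
          using that A(1) p(2) by (auto simp: c_def)
      qed
      then show False using A(1) unfolding S_def by blast
    qed
    have "\<not> m * (k - c) < card S"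
    proof
      assume "m * (k - c) < card S"
      then obtain B where B: "B \<subseteq> S" "card B = Suc m"
          "\<forall>v\<in>B. \<forall>w\<in>B. v \<noteq> w \<longrightarrow> \<not> red {v, w}"
        using independent_set_of_few_right_neighbours
          [where S = S and r = r and m = m and d = "k - c" and red = red, OF S(2,3) _ few] by metis
      have "\<exists>v\<in>B. \<exists>w\<in>B. v \<noteq> w \<and> red {v, w}"
        using B(1,2) S(1) by (intro no_blue) simp_all
      then show False using B(3) by metis
    qed
    moreover have "card (?bad k) \<le> card (?bad c) + card S"
    proof -
      have "card (?bad k) \<le> card (?bad c \<union> S)"
        using assms(1) by (intro card_mono) (auto simp: S_def)
      also have "\<dots> \<le> card (?bad c) + card S" by (rule card_Un_le)
      finally show ?thesis .
    qed
    moreover have "card (?bad c) \<le> c * m"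
      using less.IH[OF c] c less.prems by simp
    ultimately have "card (?bad k) \<le> c * m + m * (k - c)" by linarith
    also have "\<dots> = k * m" using c by (simp add: algebra_simps flip: distrib_left)
    finally show ?thesis .
  qed
qed

lemma monochromatic_drawing_exists:
  fixes r :: "'b \<Rightarrow> real" and col :: "'b set \<Rightarrow> bool"
  assumes "finite P" "inj_on r P" "star_sequence par (Suc m)" "m * m < card P"
  shows "\<exists>b p. red_drawing P r (\<lambda>e. col e = b) par m p"
proof (cases "\<exists>B\<subseteq>P. card B = Suc m \<and> (\<forall>v\<in>B. \<forall>w\<in>B. v \<noteq> w \<longrightarrow> \<not> col {v, w})")
  case True
  then obtain B where B: "B \<subseteq> P" "card B = Suc m" "\<And>v w. v \<in> B \<Longrightarrow> w \<in> B \<Longrightarrow> v \<noteq> w \<Longrightarrow> \<not> col {v, w}"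
    by blast
  have "finite B" "inj_on r B"
    using B(1) assms(1,2) by (auto intro: finite_subset inj_on_subset)
  then obtain q where q: "\<And>i. i < card B \<Longrightarrow> q i \<in> B"
    "\<And>i j. i < j \<Longrightarrow> j < card B \<Longrightarrow> r (q i) < r (q j)"
    using increasing_enumeration by blast
  have "\<not> col {q (par j), q j}" if "0 < j" "j \<le> m" for j
  proof -
    have "par j < j" using that by (intro star_sequence_less[OF assms(3)]) auto
    then have "q (par j) \<noteq> q j" using q(2)[of "par j" j] that B(2) by auto
    then show ?thesis using q(1) B(2,3) that \<open>par j < j\<close> by simp
  qed
  then have "red_drawing P r (\<lambda>e. col e = False) par m q"
    using q B(1,2) unfolding red_drawing_def by auto
  then show ?thesis by blast
next
  case False
  have "card {v \<in> P. \<nexists>p. red_drawing P r col par m p \<and> p m = v} \<le> m * m"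
  proof (rule few_points_end_no_red_drawing[where red = col, OF assms(1-3)])
    show "\<exists>v\<in>B. \<exists>w\<in>B. v \<noteq> w \<and> col {v, w}" if "B \<subseteq> P" "card B = Suc m" for B
      using False that by metis
  qed simp
  then have "{v \<in> P. \<nexists>p. red_drawing P r col par m p \<and> p m = v} \<noteq> P"
    using assms(4) by force
  then obtain p where "red_drawing P r col par m p" by blast
  then have "red_drawing P r (\<lambda>e. col e = True) par m p" by simp
  then show ?thesis by blast
qed

section \<open>Non-crossing drawings\<close>

text \<open>
  The functional \<open>x \<mapsto> x\<^sub>1 + t x\<^sub>2\<close> identifies two distinct points for at most one value of
  \<open>t\<close>, so all but finitely many \<open>t\<close> are suitable.
\<close>
lemma generic_linear_functional:
  fixes P :: "point set"
  assumes "finite P"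
  obtains r :: "point \<Rightarrow> real" where "linear r" "inj_on r P"
proof -
  define slopes where "slopes = (\<lambda>(a, b). - (a $ 1 - b $ 1) / (a $ 2 - b $ 2)) ` (P \<times> P)"
  have "finite slopes"
    unfolding slopes_def using assms by (intro finite_imageI finite_cartesian_product)
  then obtain t :: real where t: "t \<notin> slopes"
    using ex_new_if_finite[OF infinite_UNIV_char_0] by blast
  define r where "r x = x $ 1 + t * x $ 2" for x :: point
  have "linear r"
    by (rule linearI) (auto simp: r_def algebra_simps)
  moreover have "inj_on r P"
  proof (rule inj_onI)
    fix a b assume ab: "a \<in> P" "b \<in> P" "r a = r b"
    have eq: "t * (a $ 2 - b $ 2) = - (a $ 1 - b $ 1)"
      using ab(3) by (simp add: r_def algebra_simps)
    have "a $ 2 = b $ 2"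
    proof (rule ccontr)
      assume "a $ 2 \<noteq> b $ 2"
      then have "t = - (a $ 1 - b $ 1) / (a $ 2 - b $ 2)"
        using eq by (simp add: field_simps)
      then have "t \<in> slopes"
        unfolding slopes_def using ab(1,2) by (intro image_eqI[of _ _ "(a, b)"]) simp_all
      then show False using t by simp
    qed
    moreover from this have "a $ 1 = b $ 1" using eq by simp
    ultimately show "a = b" by (simp add: vec_eq_iff forall_2)
  qed
  ultimately show ?thesis using that by blast
qed

lemma linear_open_segment_between:
  fixes r :: "'b::real_vector \<Rightarrow> real"
  assumes "linear r" "x \<in> open_segment a b" "r a < r b"
  shows "r a < r x" "r x < r b"
proof -
  obtain u where u: "0 < u" "u < 1" "x = (1 - u) *\<^sub>R a + u *\<^sub>R b"
    using assms(2) by (auto simp: in_segment)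
  have "r x = (1 - u) * r a + u * r b"
    using assms(1) u(3) by (simp add: linear_add linear_scale)
  then have eq: "r x - r a = u * (r b - r a)" "r b - r x = (1 - u) * (r b - r a)"
    by (simp_all add: algebra_simps)
  have "0 < r x - r a" "0 < r b - r x"
    unfolding eq using u assms(3) by simp_all
  then show "r a < r x" "r x < r b" by simp_all
qed

lemma segments_from_common_point:
  fixes a b c :: "'b::euclidean_space"
  assumes "\<not> collinear {a, b, c}"
  shows "open_segment a b \<inter> open_segment a c = {}"
proof (rule ccontr)
  assume "\<not> ?thesis"
  then obtain x where x: "x \<in> open_segment a b" "x \<in> open_segment a c" by blast
  then have "x \<noteq> a" by (auto simp: open_segment_def)
  have "collinear {a, x, b}" "collinear {a, x, c}"
    using x by (auto simp: open_segment_def between_mem_segment[symmetric] between_imp_collinear)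
  then have "collinear {b, a, c}"
    using \<open>x \<noteq> a\<close> by (intro collinear_3_trans[of b a x c]) (auto simp: insert_commute)
  then show False using assms by (simp add: insert_commute)
qed

text \<open>
  For \<open>i < j\<close> there are two cases. If \<open>par j < i\<close>, then \<open>i\<close> and \<open>j\<close> belong to the same
  star and the edges leave a common point in different directions, by general position. If \<open>par j \<ge> i\<close>, the first
  edge ends no further to the right than the second one begins.
\<close>
lemma star_sequence_drawing_non_crossing:
  fixes r :: "point \<Rightarrow> real"
  assumes "linear r" "general_position P" "star_sequence par n"
    and p_in: "\<And>i. i < n \<Longrightarrow> p i \<in> P"
    and mono: "\<And>i j. i < j \<Longrightarrow> j < n \<Longrightarrow> r (p i) < r (p j)"
  shows "non_crossing \<lparr>verts = V, edges = {{p (par k), p k} | k. 0 < k \<and> k < n}\<rparr>"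
proof -
  have par_lt: "par k < k" if "0 < k" "k < n" for k
    using star_sequence_less[OF assms(3) that] .
  have disjoint: "open_segment (p (par i)) (p i) \<inter> open_segment (p (par j)) (p j) = {}"
    if ij: "0 < i" "i < j" "j < n" for i j
  proof (cases "par j < i")
    case True
    then have eq: "par i = par j"
      using ij by (intro star_sequence_const[OF assms(3)]) auto
    have "r (p (par j)) < r (p i)" "r (p i) < r (p j)"
      using mono True ij by auto
    then have "p (par j) \<noteq> p i" "p i \<noteq> p j" "p (par j) \<noteq> p j" by auto
    moreover have "p (par j) \<in> P" "p i \<in> P" "p j \<in> P"
      using p_in True ij by auto
    ultimately have "\<not> collinear {p (par j), p i, p j}"
      using assms(2) unfolding general_position_def by blast
    then show ?thesis unfolding eq by (rule segments_from_common_point)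
  next
    case False
    have "r (p i) \<le> r (p (par j))"
      using mono[of i "par j"] par_lt[of j] False ij by (cases "i = par j") auto
    moreover have "r x < r (p i)" if "x \<in> open_segment (p (par i)) (p i)" for x
      using linear_open_segment_between(2)[OF assms(1) that] mono par_lt[of i] ij by auto
    moreover have "r (p (par j)) < r x" if "x \<in> open_segment (p (par j)) (p j)" for x
      using linear_open_segment_between(1)[OF assms(1) that] mono par_lt[of j] ij by auto
    ultimately show ?thesis by fastforce
  qed
  have "\<not> edges_cross {p (par i), p i} {p (par j), p j}"
    if "0 < i" "i < n" "0 < j" "j < n" for i j
  proof (cases "i = j")
    case True
    then show ?thesis by (simp add: edges_cross_def)
  next
    case False
    then have "open_segment (p (par i)) (p i) \<inter> open_segment (p (par j)) (p j) = {}"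
      using disjoint[of i j] disjoint[of j i] that by (cases "i < j") auto
    then show ?thesis
      unfolding edges_cross_def by (auto simp: doubleton_eq_iff open_segment_commute)
  qed
  then show ?thesis unfolding non_crossing_def by auto
qed

section \<open>The quadratic bound\<close>

lemma caterpillar_ramsey_property:
  assumes "caterpillar T"
  shows "geometric_ramsey_property T ((card (verts T))\<^sup>2)"
  unfolding geometric_ramsey_property_def
proof (intro allI impI)
  fix P :: "point set" and col :: "point set \<Rightarrow> bool"
  assume P: "general_position P \<and> card P = (card (verts T))\<^sup>2"
  obtain z where "swept (verts T) (edges T) z"
    using caterpillar_swept[OF assms] .
  then obtain par L c where L: "star_sequence par (length L)" "distinct L" "set L = verts T"
      "edges T = {{L ! par k, L ! k} | k. 0 < k \<and> k < length L}" "c < length L"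
    unfolding swept_def by blast
  define n where "n = length L"
  define m where "m = n - 1"
  have n: "n = Suc m" "n = card (verts T)"
    using L(5) distinct_card[OF L(2)] L(3) by (auto simp: n_def m_def)
  have par_lt: "par k < k" if "0 < k" "k < n" for k
    using that unfolding n_def by (rule star_sequence_less[OF L(1)])
  have "finite P" using P unfolding general_position_def by simp
  obtain r :: "point \<Rightarrow> real" where r: "linear r" "inj_on r P"
    using generic_linear_functional[OF \<open>finite P\<close>] .
  have "m * m < card P"
    using P n by (simp add: power2_eq_square)
  then obtain b p where "red_drawing P r (\<lambda>e. col e = b) par m p"
    using monochromatic_drawing_exists[OF \<open>finite P\<close> r(2) L(1)[folded n_def, unfolded n(1)]] by blast
  then have p: "\<And>i. i < n \<Longrightarrow> p i \<in> P" "\<And>i j. i < j \<Longrightarrow> j < n \<Longrightarrow> r (p i) < r (p j)"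
      "\<And>k. 0 < k \<Longrightarrow> k < n \<Longrightarrow> col {p (par k), p k} = b"
    using n(1) unfolding red_drawing_def by (auto simp: less_Suc_eq_le)
  have inj_p: "inj_on p {..<n}"
    by (rule linorder_inj_onI) (use p(2) in force)+
  define H where "H = \<lparr>verts = p ` {..<n}, edges = {{p (par k), p k} | k. 0 < k \<and> k < n}\<rparr>"
  have edge: "{p (par k), p k} \<subseteq> p ` {..<n} \<and> card {p (par k), p k} = 2"
    if "0 < k" "k < n" for k
  proof -
    have "p (par k) \<noteq> p k"
      using p(2)[OF par_lt[OF that] that(2)] by auto
    then show ?thesis
      using par_lt[OF that] that by simp
  qed
  have "simple_graph H"
    using edge unfolding simple_graph_def H_def by auto
  moreover have "verts H \<subseteq> P" using p(1) unfolding H_def by auto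
  ultimately have "subgraph_of H (complete_geometric P)"
    unfolding subgraph_of_def complete_geometric_def simple_graph_def by auto
  moreover have "monochromatic col H"
    unfolding monochromatic_def H_def using p(3) by auto
  moreover have "non_crossing H"
    unfolding H_def
    by (rule star_sequence_drawing_non_crossing[OF r(1) _ L(1)[folded n_def]]) (use P p in auto)
  moreover have "isomorphic T H"
  proof -
    have bij_L: "bij_betw ((!) L) {..<n} (verts T)"
      using bij_betw_nth[OF L(2)] L(3) n_def by auto
    define f where "f = p \<circ> the_inv_into {..<n} ((!) L)"
    have "bij_betw f (verts T) (verts H)"
      unfolding f_def H_def using bij_betw_the_inv_into[OF bij_L] inj_p
      by (auto intro: bij_betw_trans inj_on_imp_bij_betw)
    moreover have f_nth: "f (L ! k) = p k" if "k < n" for k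
      using bij_L that by (simp add: f_def bij_betw_def the_inv_into_f_f)
    have "edges H = (\<lambda>e. f ` e) ` edges T"
    proof -
      have "f ` {L ! par k, L ! k} = {p (par k), p k}" if "0 < k" "k < n" for k
        using f_nth[of k] f_nth[of "par k"] par_lt[OF that] that by simp
      then have "(\<lambda>k. {p (par k), p k}) ` {k. 0 < k \<and> k < n} =
          (\<lambda>k. f ` {L ! par k, L ! k}) ` {k. 0 < k \<and> k < n}"
        by (intro image_cong refl) (simp only: mem_Collect_eq)
      then show ?thesis
        unfolding H_def L(4) n_def[symmetric]
        by (simp only: ugraph.simps setcompr_eq_image image_image)
    qed
    ultimately show ?thesis unfolding isomorphic_def by blast
  qed
  ultimately show "\<exists>H. subgraph_of H (complete_geometric P) \<and> monochromatic col H \<and>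
      non_crossing H \<and> isomorphic T H"
    by blast
qed

theorem corollary9:
  fixes K :: real
  shows "\<exists>C::real. C > 0 \<and>
    (\<forall>n::nat. \<forall>T :: 'a ugraph.
       n \<ge> 1 \<longrightarrow> caterpillar T \<longrightarrow> card (verts T) = n \<longrightarrow>
       real (max_degree T) \<le> K \<or> real (card (nonleaf_verts T)) \<le> K \<longrightarrow>
       ereal_of_enat (geometric_ramsey_number T) \<le> ereal (C * real n ^ 2))"
proof -
  have "ereal_of_enat (geometric_ramsey_number T) \<le> ereal (1 * real n ^ 2)"
    if "caterpillar T" "card (verts T) = n" for n and T :: "'a ugraph"
  proof -
    have "geometric_ramsey_number T \<le> enat (n\<^sup>2)"
      using caterpillar_ramsey_property[OF that(1)] that(2)
      unfolding geometric_ramsey_number_def by (auto intro!: Inf_lower)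
    then have "ereal_of_enat (geometric_ramsey_number T) \<le> ereal_of_enat (enat (n\<^sup>2))"
      by (simp only: ereal_of_enat_le_iff)
    then show ?thesis by simp
  qed
  then show ?thesis by (intro exI[of _ 1]) auto
qed

end
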